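(* Let $P\in\mathcal{M}^1_K(\lambda)$ be such that $\inf_{Q\in\mathcal{M}}D_\alpha(Q,P)$ is finite. For any closed convex set $\Omega$ in $\mathcal{M}_{\mathcal{E}}$, the $D_\alpha$-projection of $P$ on $\Omega$ exists and is unique.
   Context: Setting. $K\subset\mathbb{R}^m$ is compact, $\lambda$ is Lebesgue measure on $K$, $\Theta\subset\mathbb{R}^d$ is compact, $\alpha\in(0,1]$ is fixed, and $g=(g_1,\dots,g_l)^T:K\times\Theta\to\mathbb{R}^l$ with $l\le d$ and $g_1,\dots,g_l$ linearly independent. Assumptions on $g$: it is continuous on $\mathrm{int}(K)\times\mathrm{int}(\Theta)$; $\sup_{\theta\in\Theta}\sup_{x\in K}\|g(x,\theta)\|<\infty$; and $\sup_{x\in K}\|g(x,\theta_n)-g(x,\underline\theta)\|\to0$ whenever $\theta_n\to\underline\theta$. Function class. $E$ is a set of nonnegative functions in $\mathcal{C}_b(K)$ (bounded continuous functions on $K$), with metric $d(q,q')=\sup_{x\in K}|q(x)-q'(x)|$. Assumptions: (E1) $\sup_{q\in E}\sup_{x\in K}|q(x)|<\infty$; (E2) there is $M<\infty$ with $|q^\alpha(x)-q^\alpha(y)|\le M|x-y|$ for all $q\in E$, $x,y\in K$, where moreover either (i) $\inf_{q\in E}\inf_{x\in K}q(x)>\gamma$ for some $\gamma>0$ and $q^\delta$ is Lipschitz uniformly over $q\in E$ for some $\delta\in(0,1]$, or (ii) $E$ has no such uniform positive lower bound and $q^\delta$ is Lipschitz uniformly over $q\in E$ for some $\delta$ with $0<\delta<\alpha$.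 Model. $\mathcal{M}^1_K$ is the set of probability measures supported on $K$, and $\mathcal{M}^1_K(\lambda)$ its subset of measures absolutely continuous with respect to $\lambda$. $\mathcal{E}$ is the class of nonnegative finite measures $Q$ on $K$ with density $q=dQ/d\lambda\in E$. For $\theta\in\Theta$, $\mathcal{M}_\theta=\{Q\in\mathcal{M}^1_K:\int g(x,\theta)\,dQ(x)=0\}$ and $\mathcal{M}_{\theta,\mathcal{E}}=\mathcal{M}_\theta\cap\mathcal{E}$, assumed nonempty; $\mathcal{M}=\bigcup_{\theta\in\Theta}\mathcal{M}_\theta$, $\mathcal{M}_{\mathcal{E}}=\bigcup_{\theta\in\Theta}\mathcal{M}_{\theta,\mathcal{E}}$. Standing identifiability assumptions: (M1) $\mathcal{M}_\theta\cap\mathcal{M}_{\theta'}=\emptyset$ for $\theta\ne\theta'$; (M2) for each $\epsilon>0$ there is $\delta>0$ such that $d(\theta,\theta')>\epsilon$ implies $\inf\{d(q,q'):Q\in\mathcal{M}_{\theta,\mathcal{E}},Q'\in\mathcal{M}_{\theta',\mathcal{E}}\}>\delta$ ($q,q'$ the densities of $Q,Q'$). Strong topology. A sequence $(Q_n)$ with densities $q_n\in E$ converges strongly to the measure $Q$ with density $q\in E$ if $\sup_{x\in K}|q_n(x)-q(x)|\to0$. "Closed" refers to this topology. Divergence. For $Q,P$ absolutely continuous with respect to $\lambda$, with densities $q,p$, $$D_\alpha(Q,P)=\int\Big\{q^{\alpha+1}(x)-\Big(1+\tfrac1\alpha\Big)q^\alpha(x)p(x)+\tfrac1\alpha p^{\alpha+1}(x)\Big\}dx\in[0,\infty],$$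 and the infimum over $\mathcal{M}$ is over $Q$ having a density. A $D_\alpha$-projection of $P$ on a (nonempty) set $\Omega$ is a $Q^*\in\Omega$ with $D_\alpha(Q^*,P)<\infty$ and $D_\alpha(Q^*,P)\le D_\alpha(Q,P)$ for all $Q\in\Omega$.
   Formalization: Two corrections, as the claim fails otherwise: the density p of P is assumed to have p^(α+1) integrable (equivalent to finite D_α(Q,P) on Ω), and "closed" means closed under uniform limits of densities in C_b(K), not only limits in E (same if E is closed). Ω is nonempty. *)

theory Defs
  imports "HOL-Analysis.Analysis" "HOL-Probability.Probability_Measure"
begin

text \<open>
  Functions on \<open>K\<close> and on \<open>K \<times> \<Theta>\<close> are total functions of which only the values on \<open>K\<close>, resp.
  \<open>K \<times> \<Theta>\<close>, are ever used. Measures on \<open>K\<close> have \<open>K\<close> itself as underlying space.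
\<close>

definition leb_on :: "'a::euclidean_space set \<Rightarrow> 'a measure" where
  "leb_on K = restrict_space lborel K"

definition prob_measures :: "'a::euclidean_space set \<Rightarrow> 'a measure set" where
  "prob_measures K = {Q. prob_space Q \<and> sets Q = sets (leb_on K)}"

definition ac_prob_measures :: "'a::euclidean_space set \<Rightarrow> 'a measure set" where
  "ac_prob_measures K = {Q \<in> prob_measures K. absolutely_continuous (leb_on K) Q}"

definition Cb :: "'a::topological_space set \<Rightarrow> ('a \<Rightarrow> real) set" where
  "Cb K = {q. continuous_on K q \<and> bounded (q ` K)}"

definition sup_dist :: "'a set \<Rightarrow> ('a \<Rightarrow> real) \<Rightarrow> ('a \<Rightarrow> real) \<Rightarrow> real" where
  "sup_dist K q q' = (SUP x\<in>K. \<bar>q x - q' x\<bar>)"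

definition measure_of_density :: "'a::euclidean_space set \<Rightarrow> ('a \<Rightarrow> real) \<Rightarrow> 'a measure" where
  "measure_of_density K q = density (leb_on K) (\<lambda>x. ennreal (q x))"

definition density_class :: "'a::euclidean_space set \<Rightarrow> ('a \<Rightarrow> real) set \<Rightarrow> 'a measure set" where
  "density_class K E = measure_of_density K ` E"

text \<open>Integrability is required explicitly since the Bochner integral is \<open>0\<close> by convention otherwise.\<close>

definition moment_model ::
  "'a::euclidean_space set \<Rightarrow> ('a \<Rightarrow> 'b \<Rightarrow> real ^ 'l) \<Rightarrow> 'b \<Rightarrow> 'a measure set" where
  "moment_model K g \<theta> =
     {Q \<in> prob_measures K. integrable Q (\<lambda>x. g x \<theta>) \<and> (\<integral>x. g x \<theta> \<partial>Q) = 0}"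

definition moment_model_E ::
  "'a::euclidean_space set \<Rightarrow> ('a \<Rightarrow> 'b \<Rightarrow> real ^ 'l) \<Rightarrow> ('a \<Rightarrow> real) set \<Rightarrow> 'b \<Rightarrow> 'a measure set" where
  "moment_model_E K g E \<theta> = moment_model K g \<theta> \<inter> density_class K E"

definition has_uniform_lower_bound :: "'a set \<Rightarrow> ('a \<Rightarrow> real) set \<Rightarrow> bool" where
  "has_uniform_lower_bound K E \<longleftrightarrow> (\<exists>\<gamma>>0. \<forall>q\<in>E. \<forall>x\<in>K. \<gamma> < q x)"

definition uniformly_lipschitz_powr :: "'a::metric_space set \<Rightarrow> ('a \<Rightarrow> real) set \<Rightarrow> real \<Rightarrow> bool" where
  "uniformly_lipschitz_powr K E a \<longleftrightarrow> (\<exists>L. \<forall>q\<in>E. L-lipschitz_on K (\<lambda>x. q x powr a))"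

definition dens :: "'a::euclidean_space set \<Rightarrow> 'a measure \<Rightarrow> 'a \<Rightarrow> real" where
  "dens K Q x = enn2real (RN_deriv (leb_on K) Q x)"

text \<open>
  The integrand is nonnegative for \<open>\<alpha> > 0\<close>, so the conversion to \<^typ>\<open>ennreal\<close> truncates nothing.
\<close>

definition D_div :: "'a::euclidean_space set \<Rightarrow> real \<Rightarrow> 'a measure \<Rightarrow> 'a measure \<Rightarrow> ennreal" where
  "D_div K \<alpha> Q P =
     (\<integral>\<^sup>+x. ennreal (dens K Q x powr (\<alpha> + 1)
                   - (1 + 1 / \<alpha>) * dens K Q x powr \<alpha> * dens K P x
                   + 1 / \<alpha> * dens K P x powr (\<alpha> + 1)) \<partial>leb_on K)"

definition is_D_projection ::
  "'a::euclidean_space set \<Rightarrow> real \<Rightarrow> 'a measure \<Rightarrow> 'a measure set \<Rightarrow> 'a measure \<Rightarrow> bool" where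
  "is_D_projection K \<alpha> P \<Omega> Q' \<longleftrightarrow>
     Q' \<in> \<Omega> \<and> D_div K \<alpha> Q' P < \<infinity> \<and> (\<forall>Q\<in>\<Omega>. D_div K \<alpha> Q' P \<le> D_div K \<alpha> Q P)"

definition strongly_converges ::
  "'a::euclidean_space set \<Rightarrow> ('a \<Rightarrow> real) set \<Rightarrow> (nat \<Rightarrow> 'a measure) \<Rightarrow> 'a measure \<Rightarrow> bool" where
  "strongly_converges K E Qs Q \<longleftrightarrow>
     (\<exists>qs q. (\<forall>n. qs n \<in> E \<and> Qs n = measure_of_density K (qs n)) \<and>
             q \<in> Cb K \<and> Q = measure_of_density K q \<and> uniform_limit K qs q sequentially)"

text \<open>
  The limit density above ranges over all of \<^term>\<open>Cb K\<close>, not just over \<open>E\<close>: closedness is meant in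
  the complete space of bounded continuous functions. As \<open>E\<close> need not be closed there, closedness
  relative to \<open>E\<close> would not suffice for the existence of projections.
\<close>

definition strongly_closed :: "'a::euclidean_space set \<Rightarrow> ('a \<Rightarrow> real) set \<Rightarrow> 'a measure set \<Rightarrow> bool" where
  "strongly_closed K E \<Omega> \<longleftrightarrow>
     (\<forall>Qs Q. (\<forall>n. Qs n \<in> \<Omega>) \<and> strongly_converges K E Qs Q \<longrightarrow> Q \<in> \<Omega>)"

definition mixture :: "real \<Rightarrow> 'a measure \<Rightarrow> 'a measure \<Rightarrow> 'a measure" where
  "mixture t Q R = measure_of (space Q) (sets Q)
     (\<lambda>A. ennreal t * emeasure Q A + ennreal (1 - t) * emeasure R A)"

definition convex_measures :: "'a measure set \<Rightarrow> bool" where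
  "convex_measures \<Omega> \<longleftrightarrow> (\<forall>Q\<in>\<Omega>. \<forall>R\<in>\<Omega>. \<forall>t\<in>{0..1}. mixture t Q R \<in> \<Omega>)"

end

theory Submission
  imports Defs "HOL-Complex_Analysis.Great_Picard"
begin

text \<open>
  Identify a measure with its density \<open>q\<close> and write \<open>p\<close> for the density of \<open>P\<close>. The integrand of
  \<open>D_div\<close> is a function of \<open>q x\<close> and \<open>p x\<close> that is strictly convex in the first argument: the term
  \<open>q\<^sup>\<alpha>\<^sup>+\<^sup>1\<close> is strictly convex, and \<open>- q\<^sup>\<alpha> p\<close> is convex because \<open>\<alpha> \<le> 1\<close> and \<open>p \<ge> 0\<close>. Two
  projections whose densities differ on a set of positive measure would therefore have a mixture
  strictly closer to \<open>P\<close> (lemma \<open>integral_dpd_midpoint\<close>). This gives uniqueness.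

  For existence, take a minimising sequence in \<open>\<Omega>\<close>. Its densities are uniformly bounded and their
  \<open>\<alpha>\<close>-th powers are equi-Lipschitz, so a subsequence converges uniformly, by the Arzela--Ascoli
  theorem (lemma \<open>uniformly_convergent_subseq_powr\<close>). The limit belongs to \<open>\<Omega>\<close> since \<open>\<Omega>\<close> is closed,
  and the divergence passes to the limit by dominated convergence, the bound being integrable
  because \<open>K\<close> has finite measure and \<open>p\<^sup>\<alpha>\<^sup>+\<^sup>1\<close> is integrable (lemma \<open>integral_dpd_tendsto\<close>). On
  bounded densities the divergence is finite, so the limit is a projection.
\<close>

section \<open>The integrand of the divergence\<close>

text \<open>
  The pointwise density power divergence of Basu, Harris, Hjort and Jones, or, in other terms, the
  Bregman divergence of \<open>v\<close> from \<open>u\<close> generated by \<open>t\<^sup>\<alpha>\<^sup>+\<^sup>1 / \<alpha>\<close>.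
\<close>

definition dpd :: "real \<Rightarrow> real \<Rightarrow> real \<Rightarrow> real" where
  "dpd \<alpha> u v = u powr (\<alpha> + 1) - (1 + 1 / \<alpha>) * u powr \<alpha> * v + 1 / \<alpha> * v powr (\<alpha> + 1)"

lemma dpd_self: "\<alpha> > 0 \<Longrightarrow> u \<ge> 0 \<Longrightarrow> dpd \<alpha> u u = 0"
  by (cases "u = 0") (auto simp: dpd_def powr_add field_simps)

text \<open>
  As a function of \<open>v\<close> the integrand has derivative \<open>(1 + 1 / \<alpha>) (v\<^sup>\<alpha> - u\<^sup>\<alpha>)\<close>, so that it decreases
  until \<open>v = u\<close>, where it vanishes, and increases from there.
\<close>

lemma dpd_pos:
  assumes "\<alpha> > 0" "u \<ge> 0" "v \<ge> 0" "u \<noteq> v"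
  shows "dpd \<alpha> u v > 0"
proof -
  have deriv: "(dpd \<alpha> u has_real_derivative (1 + 1 / \<alpha>) * (w powr \<alpha> - u powr \<alpha>)) (at w)"
    if "w > 0" for w
    unfolding dpd_def using that assms(1)
    by (auto intro!: derivative_eq_intros simp: field_simps)
  have cont: "continuous_on {a..b} (dpd \<alpha> u)" if "a \<ge> 0" for a b
    unfolding dpd_def using that assms(1)
    by (intro continuous_on_add continuous_on_diff continuous_on_mult continuous_on_powr'
        continuous_on_const continuous_on_id) auto
  consider "u < v" | "v < u" using assms(4) by linarith
  then show ?thesis
  proof cases
    case 1
    have "dpd \<alpha> u u < dpd \<alpha> u v"
    proof (rule DERIV_pos_imp_increasing_open[OF 1 _ cont])
      fix w assume "u < w" "w < v"
      then show "\<exists>y. (dpd \<alpha> u has_real_derivative y) (at w) \<and> y > 0"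
        using assms deriv[of w] powr_less_mono2[of \<alpha> u w]
        by (intro exI[of _ "(1 + 1 / \<alpha>) * (w powr \<alpha> - u powr \<alpha>)"]) (auto intro!: mult_pos_pos add_pos_pos)
    qed (use assms in auto)
    then show ?thesis using assms by (simp add: dpd_self)
  next
    case 2
    have "dpd \<alpha> u v > dpd \<alpha> u u"
    proof (rule DERIV_neg_imp_decreasing_open[OF 2 _ cont])
      fix w assume "v < w" "w < u"
      then show "\<exists>y. (dpd \<alpha> u has_real_derivative y) (at w) \<and> y < 0"
        using assms deriv[of w] powr_less_mono2[of \<alpha> w u]
        by (intro exI[of _ "(1 + 1 / \<alpha>) * (w powr \<alpha> - u powr \<alpha>)"]) (auto intro!: mult_pos_neg add_pos_pos)
    qed (use assms in auto)
    then show ?thesis using assms by (simp add: dpd_self)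
  qed
qed

lemma dpd_nonneg: "\<alpha> > 0 \<Longrightarrow> u \<ge> 0 \<Longrightarrow> v \<ge> 0 \<Longrightarrow> dpd \<alpha> u v \<ge> 0"
  using dpd_pos[of \<alpha> u v] by (cases "u = v") (auto simp: dpd_self)

text \<open>
  Adding \<open>dpd \<alpha> m u > 0\<close> and \<open>dpd \<alpha> m v > 0\<close> for the midpoint \<open>m\<close> yields the claim divided by
  \<open>\<alpha>\<close>, since the tangent at \<open>m\<close> is affine and \<open>u + v = 2 m\<close>.
\<close>

lemma powr_midpoint_less:
  fixes u v :: real
  assumes "\<alpha> > 0" "u \<ge> 0" "v \<ge> 0" "u \<noteq> v"
  shows "2 * ((u + v) / 2) powr (\<alpha> + 1) < u powr (\<alpha> + 1) + v powr (\<alpha> + 1)"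
proof -
  define m where "m = (u + v) / 2"
  have m: "m > 0" "u + v = 2 * m" "m \<noteq> u" "m \<noteq> v" using assms by (auto simp: m_def)
  have "0 < dpd \<alpha> m u + dpd \<alpha> m v"
    using dpd_pos[of \<alpha> m u] dpd_pos[of \<alpha> m v] m assms by simp
  also have "\<dots> = 2 * m powr (\<alpha> + 1) - (1 + 1 / \<alpha>) * m powr \<alpha> * (u + v)
      + 1 / \<alpha> * (u powr (\<alpha> + 1) + v powr (\<alpha> + 1))"
    by (simp add: dpd_def algebra_simps add_divide_distrib)
  also have "\<dots> = 1 / \<alpha> * (u powr (\<alpha> + 1) + v powr (\<alpha> + 1) - 2 * m powr (\<alpha> + 1))"
    unfolding m(2) using m(1) by (simp add: powr_add algebra_simps)
  finally show ?thesis using assms(1) by (simp add: zero_less_divide_iff m_def)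
qed

text \<open>
  This is the preceding inequality for \<open>u\<^sup>\<alpha>\<close>, \<open>v\<^sup>\<alpha>\<close> and the inverse exponent \<open>1 / \<alpha>\<close>.
\<close>

lemma powr_midpoint_ge:
  fixes u v :: real
  assumes "0 < \<alpha>" "\<alpha> \<le> 1" "u \<ge> 0" "v \<ge> 0"
  shows "u powr \<alpha> + v powr \<alpha> \<le> 2 * ((u + v) / 2) powr \<alpha>"
proof (cases "\<alpha> = 1 \<or> u powr \<alpha> = v powr \<alpha>")
  case True
  have "u = v" if "u powr \<alpha> = v powr \<alpha>"
    using that assms powr_less_mono2[of \<alpha> u v] powr_less_mono2[of \<alpha> v u] by linarith
  with True assms show ?thesis by auto
next
  case False
  let ?x = "u powr \<alpha>" and ?y = "v powr \<alpha>"
  have "2 * ((?x + ?y) / 2) powr (1 / \<alpha>) < ?x powr (1 / \<alpha>) + ?y powr (1 / \<alpha>)"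
    using powr_midpoint_less[of "1 / \<alpha> - 1" ?x ?y] False assms by simp
  then have "((?x + ?y) / 2) powr (1 / \<alpha>) \<le> (u + v) / 2"
    using assms by (simp add: powr_powr)
  then have "(((?x + ?y) / 2) powr (1 / \<alpha>)) powr \<alpha> \<le> ((u + v) / 2) powr \<alpha>"
    using assms by (intro powr_mono2) auto
  then show ?thesis using assms by (simp add: powr_powr)
qed

lemma dpd_midpoint_less:
  assumes "0 < \<alpha>" "\<alpha> \<le> 1" "u \<ge> 0" "v \<ge> 0" "w \<ge> 0" "u \<noteq> v"
  shows "2 * dpd \<alpha> ((u + v) / 2) w < dpd \<alpha> u w + dpd \<alpha> v w"
proof -
  have "(1 + 1 / \<alpha>) * w * (u powr \<alpha> + v powr \<alpha>) \<le> (1 + 1 / \<alpha>) * w * (2 * ((u + v) / 2) powr \<alpha>)"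
    using assms by (intro mult_left_mono powr_midpoint_ge) auto
  moreover have "2 * ((u + v) / 2) powr (\<alpha> + 1) < u powr (\<alpha> + 1) + v powr (\<alpha> + 1)"
    using assms by (intro powr_midpoint_less) auto
  ultimately show ?thesis by (simp add: dpd_def algebra_simps)
qed

lemma tendsto_dpd:
  assumes "\<alpha> > 0" "(f \<longlongrightarrow> u) F" "eventually (\<lambda>n. f n \<ge> 0) F"
  shows "((\<lambda>n. dpd \<alpha> (f n) v) \<longlongrightarrow> dpd \<alpha> u v) F"
  unfolding dpd_def using assms by (intro tendsto_intros tendsto_powr2) auto

lemma dpd_le:
  assumes "\<alpha> > 0" "0 \<le> u" "u \<le> B" "v \<ge> 0"
  shows "dpd \<alpha> u v \<le> B powr (\<alpha> + 1) + 1 / \<alpha> * v powr (\<alpha> + 1)"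
proof -
  have "u powr (\<alpha> + 1) \<le> B powr (\<alpha> + 1)" using assms by (intro powr_mono2) auto
  moreover have "0 \<le> (1 + 1 / \<alpha>) * u powr \<alpha> * v" using assms by simp
  ultimately show ?thesis by (simp add: dpd_def)
qed

lemma measurable_dpd [measurable]:
  assumes [measurable]: "f \<in> borel_measurable M" "g \<in> borel_measurable M"
  shows "(\<lambda>x. dpd \<alpha> (f x) (g x)) \<in> borel_measurable M"
  unfolding dpd_def by measurable

section \<open>The integral functional on bounded densities\<close>

lemma integrable_dpd:
  assumes "finite_measure M" "\<alpha> > 0"
    and p: "p \<in> borel_measurable M" "\<And>x. p x \<ge> 0" "integrable M (\<lambda>x. p x powr (\<alpha> + 1))"
    and q: "q \<in> borel_measurable M" "\<And>x. x \<in> space M \<Longrightarrow> 0 \<le> q x \<and> q x \<le> B"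
  shows "integrable M (\<lambda>x. dpd \<alpha> (q x) (p x))"
proof -
  interpret finite_measure M by fact
  show ?thesis
  proof (rule Bochner_Integration.integrable_bound)
    show "integrable M (\<lambda>x. B powr (\<alpha> + 1) + 1 / \<alpha> * p x powr (\<alpha> + 1))"
      using p(3) by (intro Bochner_Integration.integrable_add integrable_mult_right) auto
    show "(\<lambda>x. dpd \<alpha> (q x) (p x)) \<in> borel_measurable M" using p q by measurable
    show "AE x in M. norm (dpd \<alpha> (q x) (p x)) \<le> norm (B powr (\<alpha> + 1) + 1 / \<alpha> * p x powr (\<alpha> + 1))"
    proof (rule AE_I2)
      fix x assume "x \<in> space M"
      then show "norm (dpd \<alpha> (q x) (p x)) \<le> norm (B powr (\<alpha> + 1) + 1 / \<alpha> * p x powr (\<alpha> + 1))"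
        using dpd_le[of \<alpha> "q x" B "p x"] dpd_nonneg[of \<alpha> "q x" "p x"] p(2) q(2) \<open>\<alpha> > 0\<close> by simp
    qed
  qed
qed

lemma integral_dpd_tendsto:
  assumes "finite_measure M" "\<alpha> > 0"
    and p: "p \<in> borel_measurable M" "\<And>x. p x \<ge> 0" "integrable M (\<lambda>x. p x powr (\<alpha> + 1))"
    and qs: "\<And>n. qs n \<in> borel_measurable M" "\<And>n x. x \<in> space M \<Longrightarrow> 0 \<le> qs n x \<and> qs n x \<le> B"
    and q: "q \<in> borel_measurable M" "\<And>x. x \<in> space M \<Longrightarrow> (\<lambda>n. qs n x) \<longlonglongrightarrow> q x"
  shows "(\<lambda>n. \<integral>x. dpd \<alpha> (qs n x) (p x) \<partial>M) \<longlonglongrightarrow> (\<integral>x. dpd \<alpha> (q x) (p x) \<partial>M)"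
proof -
  interpret finite_measure M by fact
  show ?thesis
  proof (rule integral_dominated_convergence[where w = "\<lambda>x. B powr (\<alpha> + 1) + 1 / \<alpha> * p x powr (\<alpha> + 1)"])
    show "integrable M (\<lambda>x. B powr (\<alpha> + 1) + 1 / \<alpha> * p x powr (\<alpha> + 1))"
      using p(3) by (intro Bochner_Integration.integrable_add integrable_mult_right) auto
    show "(\<lambda>x. dpd \<alpha> (q x) (p x)) \<in> borel_measurable M" using p q by measurable
    show "(\<lambda>x. dpd \<alpha> (qs n x) (p x)) \<in> borel_measurable M" for n using p(1) qs(1)[of n] by measurable
    show "AE x in M. (\<lambda>n. dpd \<alpha> (qs n x) (p x)) \<longlonglongrightarrow> dpd \<alpha> (q x) (p x)"
      using assms(2) q(2) qs(2) by (intro AE_I2 tendsto_dpd always_eventually) auto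
    show "AE x in M. norm (dpd \<alpha> (qs n x) (p x)) \<le> B powr (\<alpha> + 1) + 1 / \<alpha> * p x powr (\<alpha> + 1)" for n
    proof (rule AE_I2)
      fix x assume "x \<in> space M"
      then show "norm (dpd \<alpha> (qs n x) (p x)) \<le> B powr (\<alpha> + 1) + 1 / \<alpha> * p x powr (\<alpha> + 1)"
        using dpd_le[of \<alpha> "qs n x" B "p x"] dpd_nonneg[of \<alpha> "qs n x" "p x"] p(2) qs(2) \<open>\<alpha> > 0\<close> by simp
    qed
  qed
qed

text \<open>
  The convexity defect of the integrand is nonnegative and vanishes only where \<open>q\<close> and \<open>r\<close> agree.
\<close>

lemma integral_dpd_midpoint:
  assumes "finite_measure M" "0 < \<alpha>" "\<alpha> \<le> 1"
    and p: "p \<in> borel_measurable M" "\<And>x. p x \<ge> 0" "integrable M (\<lambda>x. p x powr (\<alpha> + 1))"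
    and q: "q \<in> borel_measurable M" "\<And>x. x \<in> space M \<Longrightarrow> 0 \<le> q x \<and> q x \<le> B"
    and r: "r \<in> borel_measurable M" "\<And>x. x \<in> space M \<Longrightarrow> 0 \<le> r x \<and> r x \<le> B"
    and le: "(\<integral>x. dpd \<alpha> (q x) (p x) \<partial>M) + (\<integral>x. dpd \<alpha> (r x) (p x) \<partial>M)
               \<le> 2 * (\<integral>x. dpd \<alpha> ((q x + r x) / 2) (p x) \<partial>M)"
  shows "AE x in M. q x = r x"
proof -
  define h where
    "h = (\<lambda>x. dpd \<alpha> (q x) (p x) + dpd \<alpha> (r x) (p x) - 2 * dpd \<alpha> ((q x + r x) / 2) (p x))"
  have mid: "0 \<le> (q x + r x) / 2 \<and> (q x + r x) / 2 \<le> B" if "x \<in> space M" for x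
    using q(2)[OF that] r(2)[OF that] by (simp add: field_simps)
  have meas: "(\<lambda>x. (q x + r x) / 2) \<in> borel_measurable M" using q(1) r(1) by measurable
  note int = integrable_dpd[OF assms(1,2) p q] integrable_dpd[OF assms(1,2) p r]
    integrable_dpd[OF assms(1,2) p meas mid]
  have h_pos: "h x > 0" if "x \<in> space M" "q x \<noteq> r x" for x
    using dpd_midpoint_less[of \<alpha> "q x" "r x" "p x"] that q(2) r(2) p(2) assms(2,3)
    by (simp add: h_def)
  have h_nonneg: "h x \<ge> 0" if "x \<in> space M" for x
    using h_pos[OF that] by (cases "q x = r x") (auto simp: h_def)
  have h_int: "integrable M h" unfolding h_def using int by simp
  have "integral\<^sup>L M h \<le> 0" unfolding h_def using int le by simp
  moreover have "integral\<^sup>L M h \<ge> 0" using h_nonneg by (intro Bochner_Integration.integral_nonneg_AE AE_I2)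
  ultimately have "integral\<^sup>L M h = 0" by simp
  then have "AE x in M. h x = 0"
    using integral_nonneg_eq_0_iff_AE[OF h_int] h_nonneg by (auto intro: AE_I2)
  with AE_space show ?thesis
    by eventually_elim (use h_pos in force)
qed

section \<open>Measures with a density on a compact set\<close>

lemma finite_measure_leb_on:
  assumes "compact K"
  shows "finite_measure (leb_on K)"
  using assms emeasure_compact_finite[of K] unfolding leb_on_def
  by (intro finite_measureI) (auto simp: space_restrict_space emeasure_restrict_space compact_imp_closed)

lemma space_leb_on [simp]: "space (leb_on K) = K"
  by (simp add: leb_on_def space_restrict_space)

lemma Cb_measurable: "q \<in> Cb K \<Longrightarrow> q \<in> borel_measurable (leb_on K)"
  unfolding Cb_def leb_on_def
  using borel_measurable_continuous_on_restrict[of K q]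
  by (auto cong: measurable_cong_sets simp: sets_restrict_space)

lemma dens_nonneg: "dens K Q x \<ge> 0"
  by (simp add: dens_def)

lemma dens_measurable: "dens K Q \<in> borel_measurable (leb_on K)"
  unfolding dens_def by measurable

lemma dens_measure_of_density:
  assumes "compact K" "q \<in> borel_measurable (leb_on K)" "\<And>x. x \<in> K \<Longrightarrow> 0 \<le> q x"
  shows "AE x in leb_on K. dens K (measure_of_density K q) x = q x"
proof -
  interpret finite_measure "leb_on K" using assms(1) by (rule finite_measure_leb_on)
  have "AE x in leb_on K. ennreal (q x) = RN_deriv (leb_on K) (measure_of_density K q) x"
    using assms(2) by (intro RN_deriv_unique) (auto simp: measure_of_density_def)
  with AE_space show ?thesis
    by eventually_elim (metis assms(3) dens_def enn2real_ennreal space_leb_on)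
qed

lemma D_div_measure_of_density:
  assumes "compact K" "\<alpha> > 0"
    and "integrable (leb_on K) (\<lambda>x. dens K P x powr (\<alpha> + 1))"
    and q: "q \<in> borel_measurable (leb_on K)" "\<And>x. x \<in> K \<Longrightarrow> 0 \<le> q x \<and> q x \<le> B"
  shows "D_div K \<alpha> (measure_of_density K q) P = ennreal (\<integral>x. dpd \<alpha> (q x) (dens K P x) \<partial>leb_on K)"
proof -
  have "D_div K \<alpha> (measure_of_density K q) P
      = (\<integral>\<^sup>+x. ennreal (dpd \<alpha> (dens K (measure_of_density K q) x) (dens K P x)) \<partial>leb_on K)"
    by (simp add: D_div_def dpd_def)
  also have "\<dots> = (\<integral>\<^sup>+x. ennreal (dpd \<alpha> (q x) (dens K P x)) \<partial>leb_on K)"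
    using dens_measure_of_density[OF assms(1) q(1)] q(2)
    by (intro nn_integral_cong_AE) (force elim: eventually_mono)
  also have "\<dots> = ennreal (\<integral>x. dpd \<alpha> (q x) (dens K P x) \<partial>leb_on K)"
    using q(2) assms(2)
    by (intro nn_integral_eq_integral integrable_dpd[OF finite_measure_leb_on[OF assms(1)] assms(2)
          dens_measurable dens_nonneg assms(3) q(1)] AE_I2 dpd_nonneg dens_nonneg) auto
  finally show ?thesis .
qed

lemma mixture_density:
  assumes "t \<in> {0..1}" and [measurable]: "q \<in> borel_measurable M" "r \<in> borel_measurable M"
    and "\<And>x. x \<in> space M \<Longrightarrow> 0 \<le> q x" "\<And>x. x \<in> space M \<Longrightarrow> 0 \<le> r x"
  shows "mixture t (density M (\<lambda>x. ennreal (q x))) (density M (\<lambda>x. ennreal (r x)))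
           = density M (\<lambda>x. ennreal (t * q x + (1 - t) * r x))"
proof -
  have "ennreal t * emeasure (density M (\<lambda>x. ennreal (q x))) A
        + ennreal (1 - t) * emeasure (density M (\<lambda>x. ennreal (r x))) A
      = (\<integral>\<^sup>+x. ennreal (t * q x + (1 - t) * r x) * indicator A x \<partial>M)" if [measurable]: "A \<in> sets M" for A
  proof -
    have "ennreal t * emeasure (density M (\<lambda>x. ennreal (q x))) A
        + ennreal (1 - t) * emeasure (density M (\<lambda>x. ennreal (r x))) A
      = (\<integral>\<^sup>+x. ennreal t * (ennreal (q x) * indicator A x)
               + ennreal (1 - t) * (ennreal (r x) * indicator A x) \<partial>M)"
      by (subst nn_integral_add) (auto simp: emeasure_density nn_integral_cmult)
    also have "\<dots> = (\<integral>\<^sup>+x. ennreal (t * q x + (1 - t) * r x) * indicator A x \<partial>M)"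
      using assms by (intro nn_integral_cong) (auto simp: ennreal_mult' ennreal_plus split: split_indicator)
    finally show ?thesis .
  qed
  then show ?thesis
    unfolding mixture_def density_def[of M "\<lambda>x. ennreal (t * q x + (1 - t) * r x)"]
    by (simp only: space_density sets_density, intro measure_of_eq) (auto simp: sets.space_closed sets.sigma_sets_eq)
qed

section \<open>Compactness of the density class\<close>

text \<open>
  The Arzela--Ascoli theorem applies to the \<open>\<alpha>\<close>-th powers, which are equi-Lipschitz; the inverse
  power is uniformly continuous on a bounded interval and so preserves uniform convergence.
\<close>

lemma uniformly_convergent_subseq_powr:
  fixes K :: "'a::euclidean_space set"
  assumes "compact K" "\<alpha> > 0" "uniformly_lipschitz_powr K E \<alpha>"
    and qs: "\<And>n. qs n \<in> E" "\<And>n x. x \<in> K \<Longrightarrow> 0 \<le> qs n x \<and> qs n x \<le> B"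
  obtains q k where "strict_mono (k :: nat \<Rightarrow> nat)" "continuous_on K q"
    "uniform_limit K (\<lambda>n. qs (k n)) q sequentially"
proof -
  obtain L where L: "\<And>q. q \<in> E \<Longrightarrow> L-lipschitz_on K (\<lambda>x. q x powr \<alpha>)"
    using assms(3) by (auto simp: uniformly_lipschitz_powr_def)
  have L0: "L \<ge> 0" using L[OF qs(1)] lipschitz_on_nonneg by blast
  have range: "qs n x powr \<alpha> \<in> {0..B powr \<alpha>}" if "x \<in> K" for n x
    using qs(2)[OF that] assms(2) by (auto intro: powr_mono2)
  obtain s k where s: "continuous_on K s" and k: "strict_mono (k :: nat \<Rightarrow> nat)"
    and conv: "\<And>e. 0 < e \<Longrightarrow> \<exists>N. \<forall>n x. n \<ge> N \<and> x \<in> K \<longrightarrow> norm (qs (k n) x powr \<alpha> - s x) < e"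
  proof (rule Arzela_Ascoli[OF assms(1), of "\<lambda>n x. qs n x powr \<alpha>" "B powr \<alpha>"])
    show "norm (qs n x powr \<alpha>) \<le> B powr \<alpha>" if "x \<in> K" for n x
      using range[OF that, of n] by simp
  next
    fix x :: 'a and e :: real assume x: "x \<in> K" and e: "0 < e"
    have "norm (qs n x powr \<alpha> - qs n y powr \<alpha>) < e" if "y \<in> K" "norm (x - y) < e / (L + 1)" for n y
    proof -
      have "norm (qs n x powr \<alpha> - qs n y powr \<alpha>) \<le> L * norm (x - y)"
        using lipschitz_onD[OF L[OF qs(1)] x that(1)] by (simp add: dist_norm)
      also have "\<dots> \<le> (L + 1) * norm (x - y)" by (intro mult_right_mono) auto
      also have "\<dots> < e" using that(2) L0 by (simp add: field_simps)
      finally show ?thesis .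
    qed
    moreover have "0 < e / (L + 1)" using e L0 by simp
    ultimately show "\<exists>d. 0 < d \<and> (\<forall>n y. y \<in> K \<and> norm (x - y) < d
        \<longrightarrow> norm (qs n x powr \<alpha> - qs n y powr \<alpha>) < e)" by blast
  qed (rule that)
  have lim: "uniform_limit K (\<lambda>n x. qs (k n) x powr \<alpha>) s sequentially"
    unfolding uniform_limit_sequentially_iff dist_norm using conv by blast
  have s_range: "s ` K \<subseteq> {0..B powr \<alpha>}"
    using closed_sequentially[OF closed_atLeastAtMost range tendsto_uniform_limitI[OF lim]] by blast
  have cont: "continuous_on {0..B powr \<alpha>} (\<lambda>y. y powr (1 / \<alpha>))"
    using assms(2) by (intro continuous_on_powr' continuous_on_const continuous_on_id) auto
  have "uniform_limit K (\<lambda>n x. (qs (k n) x powr \<alpha>) powr (1 / \<alpha>)) ((\<lambda>y. y powr (1 / \<alpha>)) \<circ> s) sequentially"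
    using range s_range
    by (intro uniform_limit_compose[OF lim compact_uniformly_continuous[OF cont]] always_eventually) auto
  then have "uniform_limit K (\<lambda>n. qs (k n)) (\<lambda>x. s x powr (1 / \<alpha>)) sequentially"
    using qs(2) assms(2) by (subst (asm) uniform_limit_cong'[of K _ "\<lambda>n. qs (k n)" _ "\<lambda>x. s x powr (1 / \<alpha>)"])
      (auto simp: powr_powr)
  moreover have "continuous_on K (\<lambda>x. s x powr (1 / \<alpha>))"
    using continuous_on_compose2[OF cont s s_range] by simp
  ultimately show thesis using that k by blast
qed

section \<open>Existence and uniqueness of the projection\<close>

theorem theorem3:
  fixes K :: "(real ^ 'm) set" and \<Theta> :: "(real ^ 'd) set" and \<alpha> :: real
    and g :: "real ^ 'm \<Rightarrow> real ^ 'd \<Rightarrow> real ^ 'l"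
    and E :: "(real ^ 'm \<Rightarrow> real) set"
    and P :: "(real ^ 'm) measure" and \<Omega> :: "(real ^ 'm) measure set"
  assumes K: "compact K" and \<Theta>: "compact \<Theta>" and \<alpha>: "0 < \<alpha>" "\<alpha> \<le> 1"
    and l_le_d: "CARD('l) \<le> CARD('d)"
    and g_indep: "\<And>c :: real ^ 'l.
      (\<forall>x\<in>K. \<forall>\<theta>\<in>\<Theta>. (\<Sum>i\<in>UNIV. c $ i * g x \<theta> $ i) = 0) \<Longrightarrow> c = 0"
    and g_cont: "continuous_on (interior K \<times> interior \<Theta>) (\<lambda>(x, \<theta>). g x \<theta>)"
    and g_bdd: "\<exists>B. \<forall>\<theta>\<in>\<Theta>. \<forall>x\<in>K. norm (g x \<theta>) \<le> B"
    and g_unif: "\<And>\<theta>s \<theta>. (\<forall>n. \<theta>s n \<in> \<Theta>) \<Longrightarrow> \<theta> \<in> \<Theta> \<Longrightarrow> \<theta>s \<longlonglongrightarrow> \<theta> \<Longrightarrow>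
      uniform_limit K (\<lambda>n x. g x (\<theta>s n)) (\<lambda>x. g x \<theta>) sequentially"
    and E_Cb: "E \<subseteq> Cb K"
    and E_nonneg: "\<And>q x. q \<in> E \<Longrightarrow> x \<in> K \<Longrightarrow> 0 \<le> q x"
    and E1: "\<exists>B. \<forall>q\<in>E. \<forall>x\<in>K. \<bar>q x\<bar> \<le> B"
    and E2: "uniformly_lipschitz_powr K E \<alpha>"
    and E2_cases:
      "(has_uniform_lower_bound K E \<and> (\<exists>\<delta>. 0 < \<delta> \<and> \<delta> \<le> 1 \<and> uniformly_lipschitz_powr K E \<delta>)) \<or>
       (\<not> has_uniform_lower_bound K E \<and> (\<exists>\<delta>. 0 < \<delta> \<and> \<delta> < \<alpha> \<and> uniformly_lipschitz_powr K E \<delta>))"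
    and nonempty: "\<And>\<theta>. \<theta> \<in> \<Theta> \<Longrightarrow> moment_model_E K g E \<theta> \<noteq> {}"
    and M1: "\<And>\<theta> \<theta>'. \<theta> \<in> \<Theta> \<Longrightarrow> \<theta>' \<in> \<Theta> \<Longrightarrow> \<theta> \<noteq> \<theta>' \<Longrightarrow>
      moment_model K g \<theta> \<inter> moment_model K g \<theta>' = {}"
    and M2: "\<And>\<epsilon>. 0 < \<epsilon> \<Longrightarrow> \<exists>\<delta>>0. \<forall>\<theta>\<in>\<Theta>. \<forall>\<theta>'\<in>\<Theta>. dist \<theta> \<theta>' > \<epsilon> \<longrightarrow>
      Inf {sup_dist K q q' | q q'. q \<in> E \<and> q' \<in> E \<and>
             measure_of_density K q \<in> moment_model_E K g E \<theta> \<and>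
             measure_of_density K q' \<in> moment_model_E K g E \<theta>'} > \<delta>"
    and P: "P \<in> ac_prob_measures K"
    and P_powr: "integrable (leb_on K) (\<lambda>x. dens K P x powr (\<alpha> + 1))"
    and P_inf: "(INF Q \<in> {Q \<in> (\<Union>\<theta>\<in>\<Theta>. moment_model K g \<theta>). absolutely_continuous (leb_on K) Q}.
      D_div K \<alpha> Q P) < \<infinity>"
    and \<Omega>: "\<Omega> \<noteq> {}" "\<Omega> \<subseteq> (\<Union>\<theta>\<in>\<Theta>. moment_model_E K g E \<theta>)"
      "strongly_closed K E \<Omega>" "convex_measures \<Omega>"
  shows "\<exists>!Q. is_D_projection K \<alpha> P \<Omega> Q"
proof -
  define J where "J q = (\<integral>x. dpd \<alpha> (q x) (dens K P x) \<partial>leb_on K)" for q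
  define F where "F = {q \<in> E. measure_of_density K q \<in> \<Omega>}"
  obtain B where B: "\<And>q x. q \<in> E \<Longrightarrow> x \<in> K \<Longrightarrow> \<bar>q x\<bar> \<le> B" using E1 by blast
  have E_meas: "q \<in> borel_measurable (leb_on K)" if "q \<in> E" for q
    using that E_Cb Cb_measurable by blast
  have E_range: "0 \<le> q x \<and> q x \<le> B" if "q \<in> E" "x \<in> K" for q x
    using B[OF that] E_nonneg[OF that] by auto
  note fin = finite_measure_leb_on[OF K]
  have D_J: "D_div K \<alpha> (measure_of_density K q) P = ennreal (J q)" if "q \<in> E" for q
    unfolding J_def using that E_meas E_range
    by (intro D_div_measure_of_density[OF K \<alpha>(1) P_powr]) auto
  have J_nonneg: "J q \<ge> 0" if "q \<in> E" for q
    unfolding J_def using that E_range \<alpha> by (intro integral_nonneg_AE AE_I2 dpd_nonneg dens_nonneg) auto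
  have \<Omega>_F: "\<exists>q\<in>F. Q = measure_of_density K q" if "Q \<in> \<Omega>" for Q
    using that \<Omega>(2) by (auto simp: moment_model_E_def density_class_def F_def)
  have F_E: "F \<subseteq> E" by (auto simp: F_def)
  have "F \<noteq> {}" using \<Omega>(1) \<Omega>_F by blast
  have bdd: "bdd_below (J ` F)" using J_nonneg F_E by (intro bdd_belowI2[of _ 0]) auto
  have proj_iff: "is_D_projection K \<alpha> P \<Omega> (measure_of_density K q) \<longleftrightarrow> (\<forall>r\<in>F. J q \<le> J r)"
    if "q \<in> F" for q
  proof -
    have "D_div K \<alpha> (measure_of_density K q) P \<le> D_div K \<alpha> (measure_of_density K r) P \<longleftrightarrow> J q \<le> J r"
      if "r \<in> F" for r
      using that \<open>q \<in> F\<close> F_E D_J J_nonneg by (auto simp: ennreal_le_iff subset_eq)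
    moreover have "D_div K \<alpha> (measure_of_density K q) P < \<infinity>"
      using that F_E D_J by (auto simp: subset_eq)
    ultimately show ?thesis
      using that \<Omega>_F unfolding is_D_projection_def F_def by (smt (verit) mem_Collect_eq)
  qed

  have "\<exists>q\<in>F. \<forall>r\<in>F. J q \<le> J r"
  proof -
    have "\<exists>q\<in>F. J q < Inf (J ` F) + 1 / real (Suc n)" for n
      using cInf_lessD[of "J ` F" "Inf (J ` F) + 1 / real (Suc n)"] \<open>F \<noteq> {}\<close> by auto
    then obtain qs where qs: "\<And>n. qs n \<in> F" "\<And>n. J (qs n) < Inf (J ` F) + 1 / real (Suc n)"
      by metis
    have qs_E: "qs n \<in> E" for n using qs(1) F_E by blast
    obtain q k where k: "strict_mono (k :: nat \<Rightarrow> nat)" and q: "continuous_on K q"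
      and lim: "uniform_limit K (\<lambda>n. qs (k n)) q sequentially"
      using uniformly_convergent_subseq_powr[OF K \<alpha>(1) E2 qs_E E_range[OF qs_E]] .
    have q_Cb: "q \<in> Cb K"
      using q compact_continuous_image[OF q K] by (auto simp: Cb_def compact_imp_bounded)
    have "measure_of_density K q \<in> \<Omega>"
    proof -
      have "strongly_converges K E (\<lambda>n. measure_of_density K (qs (k n))) (measure_of_density K q)"
        unfolding strongly_converges_def using qs_E q_Cb lim
        by (intro exI[of _ "\<lambda>n. qs (k n)"] exI[of _ q]) auto
      moreover have "measure_of_density K (qs (k n)) \<in> \<Omega>" for n
        using qs(1) by (auto simp: F_def)
      ultimately show ?thesis
        using \<Omega>(3)[unfolded strongly_closed_def, rule_format,
          of "\<lambda>n. measure_of_density K (qs (k n))" "measure_of_density K q"] by blast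
    qed
    then obtain q' where q': "q' \<in> F" "measure_of_density K q = measure_of_density K q'"
      using \<Omega>_F by blast
    have pt: "(\<lambda>n. qs (k n) x) \<longlonglongrightarrow> q x" if "x \<in> K" for x
      using tendsto_uniform_limitI[OF lim that] .
    have q_range: "0 \<le> q x \<and> q x \<le> B" if "x \<in> K" for x
      using E_range[OF qs_E that] pt[OF that] by (auto intro: LIMSEQ_le_const LIMSEQ_le_const2)
    \<comment> \<open>The limit \<open>q\<close> itself may lie outside \<open>E\<close>, but the divergence depends only on the measure,
       and this measure has a density \<open>q'\<close> in \<open>E\<close>.\<close>
    have "ennreal (J q) = ennreal (J q')"
      using D_div_measure_of_density[OF K \<alpha>(1) P_powr Cb_measurable[OF q_Cb] q_range]
        D_J[of q'] q' F_E by (auto simp: J_def)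
    moreover have "J q \<ge> 0"
      unfolding J_def using q_range \<alpha> by (intro integral_nonneg_AE AE_I2 dpd_nonneg dens_nonneg) auto
    ultimately have J_eq: "J q = J q'" using J_nonneg[of q'] q' F_E by auto
    have "(\<lambda>n. J (qs (k n))) \<longlonglongrightarrow> J q"
      unfolding J_def
      by (rule integral_dpd_tendsto[OF fin \<alpha>(1) dens_measurable dens_nonneg P_powr E_meas[OF qs_E] _
            Cb_measurable[OF q_Cb]]) (use E_range[OF qs_E] pt in auto)
    moreover have "(\<lambda>n. Inf (J ` F) + 1 / real (Suc (k n))) \<longlonglongrightarrow> Inf (J ` F) + 0"
      using LIMSEQ_subseq_LIMSEQ[OF LIMSEQ_Suc[OF lim_1_over_n] k]
      by (intro tendsto_add tendsto_const) (simp add: comp_def)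
    ultimately have "J q \<le> Inf (J ` F)"
      using LIMSEQ_le[of "\<lambda>n. J (qs (k n))" "J q"] less_imp_le[OF qs(2)] by simp
    then have "\<forall>r\<in>F. J q' \<le> J r" using J_eq cInf_lower[OF _ bdd] by force
    then show ?thesis using q'(1) by blast
  qed
  then have ex: "\<exists>Q. is_D_projection K \<alpha> P \<Omega> Q" using proj_iff by blast

  have "measure_of_density K q = measure_of_density K r"
    if "q \<in> F" "r \<in> F" and min: "\<forall>s\<in>F. J q \<le> J s" "\<forall>s\<in>F. J r \<le> J s" for q r
  proof -
    note qr = subsetD[OF F_E that(1)] subsetD[OF F_E that(2)]
    \<comment> \<open>The midpoint density need not lie in \<open>E\<close> either; the mixture has another density \<open>s\<close> there.\<close>
    let ?m = "\<lambda>x. (q x + r x) / 2"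
    have "mixture (1/2) (measure_of_density K q) (measure_of_density K r) = measure_of_density K ?m"
      using mixture_density[of "1/2" q "leb_on K" r] qr E_meas E_nonneg
      by (simp add: measure_of_density_def add_divide_distrib)
    then have "measure_of_density K ?m \<in> \<Omega>"
      using \<Omega>(4)[unfolded convex_measures_def, rule_format,
        of "measure_of_density K q" "measure_of_density K r" "1/2"] that(1,2)
      by (simp add: F_def)
    then obtain s where s: "s \<in> F" "measure_of_density K ?m = measure_of_density K s"
      using \<Omega>_F by blast
    have m_meas: "?m \<in> borel_measurable (leb_on K)"
      using qr[THEN E_meas] by measurable
    have m_range: "0 \<le> ?m x \<and> ?m x \<le> B" if "x \<in> K" for x
      using E_range[OF qr(1) that] E_range[OF qr(2) that] by (simp add: field_simps)
    have "ennreal (J ?m) = ennreal (J s)"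
      using D_div_measure_of_density[OF K \<alpha>(1) P_powr m_meas m_range] D_J[of s] s F_E
      by (auto simp: J_def)
    moreover have "J ?m \<ge> 0"
      unfolding J_def using m_range \<alpha> by (intro integral_nonneg_AE AE_I2 dpd_nonneg dens_nonneg) auto
    ultimately have "J ?m = J s" using J_nonneg[of s] s F_E by auto
    then have "J q + J r \<le> 2 * J ?m" using min s(1) by force
    then have "AE x in leb_on K. q x = r x"
      unfolding J_def
      by (intro integral_dpd_midpoint[OF fin \<alpha> dens_measurable dens_nonneg P_powr
            E_meas[OF qr(1)] _ E_meas[OF qr(2)]]) (use E_range qr in auto)
    then show ?thesis
      unfolding measure_of_density_def using qr[THEN E_meas]
      by (intro density_cong) auto
  qed
  then have "Q = R" if "is_D_projection K \<alpha> P \<Omega> Q" "is_D_projection K \<alpha> P \<Omega> R" for Q R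
    using that \<Omega>_F[of Q] \<Omega>_F[of R] proj_iff unfolding is_D_projection_def[of K \<alpha> P \<Omega>] by metis
  with ex show ?thesis by blast
qed

end
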